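(* Let $n\ge 1$ and let $I_n=\{\sigma\in S_n:\sigma^2=\mathrm{id}\}$. The polynomials $$\mathcal{I}_n^{d}(t)=\sum_{\sigma\in I_n}t^{d(\sigma)}\qquad\text{and}\qquad \mathcal{I}_n^{\mathrm{maj}}(t)=\sum_{\sigma\in I_n}t^{\mathrm{maj}(\sigma)}$$ are symmetric; that is, $[t^i]\mathcal{I}_n^{d}(t)=[t^{n-1-i}]\mathcal{I}_n^{d}(t)$ for all $0\le i\le n-1$, and $[t^j]\mathcal{I}_n^{\mathrm{maj}}(t)=[t^{\binom n2-j}]\mathcal{I}_n^{\mathrm{maj}}(t)$ for all $0\le j\le\binom n2$.
   Context: $S_n$ is the symmetric group on $\{1,\dots,n\}$, with $\sigma_i=\sigma(i)$. The descent set of $\sigma\in S_n$ is $\mathrm{Des}(\sigma)=\{i:1\le i<n,\ \sigma_i>\sigma_{i+1}\}$; $d(\sigma)=|\mathrm{Des}(\sigma)|$ is the number of descents; $\mathrm{maj}(\sigma)=\sum_{i\in\mathrm{Des}(\sigma)}i$ is the major index. $[t^i]P(t)$ denotes the coefficient of $t^i$ in $P(t)$. *)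

theory Defs
  imports "HOL-Combinatorics.Permutations" "HOL-Computational_Algebra.Polynomial"
begin

(* A permutation in S_n is a function p with "p permutes {1..n}", i.e. a bijection of nat
   that is the identity outside {1..n}. *)

definition Des :: "nat \<Rightarrow> (nat \<Rightarrow> nat) \<Rightarrow> nat set" where
  "Des n p = {i. 1 \<le> i \<and> i < n \<and> p i > p (i + 1)}"

definition des :: "nat \<Rightarrow> (nat \<Rightarrow> nat) \<Rightarrow> nat" where
  "des n p = card (Des n p)"

definition maj :: "nat \<Rightarrow> (nat \<Rightarrow> nat) \<Rightarrow> nat" where
  "maj n p = (\<Sum>i\<in>Des n p. i)"

definition involutions :: "nat \<Rightarrow> (nat \<Rightarrow> nat) set" where
  "involutions n = {p. p permutes {1..n} \<and> p \<circ> p = id}"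

definition inv_des_poly :: "nat \<Rightarrow> int poly" where
  "inv_des_poly n = (\<Sum>p\<in>involutions n. monom 1 (des n p))"

definition inv_maj_poly :: "nat \<Rightarrow> int poly" where
  "inv_maj_poly n = (\<Sum>p\<in>involutions n. monom 1 (maj n p))"

end

theory Submission
  imports Defs
begin

text \<open>
  Both symmetries follow from one refined fact: for every set \<open>S\<close> of positions there are as many
  involutions with descent set \<open>S\<close> as with ascent set \<open>S\<close>.  Passing from the descent set to its
  complement in \<open>{1..<n}\<close> turns \<open>d\<close> into \<open>n - 1 - d\<close> and \<open>maj\<close> into
  \<open>(n choose 2) - maj\<close>.  By induction on \<open>S\<close> it suffices to compare the involutions whose descent
  set is contained in \<open>S\<close> with those whose ascent set is contained in \<open>S\<close>
  (\<open>card_eq_if_card_subset_eq\<close>).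

  Cut \<open>{1..n}\<close> into blocks after each element of \<open>S\<close>.  The descents lie in \<open>S\<close> iff the involution
  is increasing on each block, and the ascents lie in \<open>S\<close> iff it is decreasing on each block.
  To an involution \<open>s\<close> attach the symmetric matrix whose \<open>(i, j)\<close> entry counts the elements of
  block \<open>i\<close> that \<open>s\<close> sends to block \<open>j\<close>.  Such a matrix comes from exactly one block-increasing
  involution: block \<open>i\<close> splits into consecutive segments, to be sent to blocks 1, 2, ... in
  this order, and the \<open>(i, j)\<close> segment is matched with the \<open>(j, i)\<close> segment increasingly.  It
  also comes from exactly one block-decreasing involution, with the segments in the opposite order
  and matched decreasingly.  Hence the two kinds of involutions are equinumerous.

  The proof below composes these two bijections into one explicit map, which needs no matrices.
  With \<open>w\<close> reversing every block and \<open>u\<close> reversing every segment of \<open>s\<close>, it is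
  \<open>s \<mapsto> w \<circ> s \<circ> u \<circ> w\<close>: the factor \<open>u\<close> turns the matching of each pair of segments around, and
  conjugation by \<open>w\<close> reverses the order of the segments in each block.  The same formula serves in
  both directions and undoes itself (\<open>exchange_correct\<close>).
\<close>

section \<open>Reversing the fibres of a function\<close>

definition fibrewise_monotone ::
    "(nat \<Rightarrow> nat \<Rightarrow> bool) \<Rightarrow> nat set \<Rightarrow> (nat \<Rightarrow> 'b) \<Rightarrow> (nat \<Rightarrow> nat) \<Rightarrow> bool" where
  "fibrewise_monotone R X f g \<longleftrightarrow> (\<forall>x\<in>X. \<forall>y\<in>X. f x = f y \<longrightarrow> x < y \<longrightarrow> R (g x) (g y))"

text \<open>
  Order reversal within each fibre of \<open>f\<close> on \<open>X\<close>, extended by the identity outside \<open>X\<close> so that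
  reversals compose as functions on all of \<open>nat\<close> and are unique as such.
\<close>

definition fibre_reversal :: "nat set \<Rightarrow> (nat \<Rightarrow> 'b) \<Rightarrow> (nat \<Rightarrow> nat) \<Rightarrow> bool" where
  "fibre_reversal X f g \<longleftrightarrow>
     (\<forall>x\<in>X. g x \<in> X \<and> f (g x) = f x) \<and> fibrewise_monotone (>) X f g \<and> (\<forall>x. x \<notin> X \<longrightarrow> g x = x)"

lemma fibrewise_monotoneD:
  "fibrewise_monotone R X f g \<Longrightarrow> x \<in> X \<Longrightarrow> y \<in> X \<Longrightarrow> f x = f y \<Longrightarrow> x < y \<Longrightarrow> R (g x) (g y)"
  by (simp add: fibrewise_monotone_def)

lemma fibre_reversalD:
  assumes "fibre_reversal X f g"
  shows "x \<in> X \<Longrightarrow> g x \<in> X"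
    and "x \<in> X \<Longrightarrow> f (g x) = f x"
    and "x \<in> X \<Longrightarrow> y \<in> X \<Longrightarrow> f x = f y \<Longrightarrow> x < y \<Longrightarrow> g y < g x"
    and "x \<notin> X \<Longrightarrow> g x = x"
  using assms unfolding fibre_reversal_def fibrewise_monotone_def by auto

text \<open>
  A strictly increasing self-map of a finite fibre lies above the identity; being injective it
  permutes \<open>X\<close>, so the sum of its values equals the sum of the arguments and no strict
  inequality is possible.
\<close>

lemma fibrewise_increasing_is_identity:
  assumes fin: "finite X"
    and closed: "\<And>x. x \<in> X \<Longrightarrow> k x \<in> X \<and> f (k x) = f x"
    and mono: "fibrewise_monotone (<) X f k"
    and "x \<in> X"
  shows "k x = x"
proof -
  have ge: "y \<in> X \<Longrightarrow> y \<le> k y" for y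
  proof (induction y rule: less_induct)
    case (less y)
    show ?case
    proof (rule ccontr)
      assume "\<not> y \<le> k y"
      then have "k y < y" by simp
      moreover from this have "k (k y) < k y"
        using fibrewise_monotoneD[OF mono] closed less.prems by metis
      ultimately show False using less closed by force
    qed
  qed
  have inj: "inj_on k X"
    by (rule inj_onI) (metis closed fibrewise_monotoneD[OF mono] less_irrefl linorder_neqE_nat)
  have "k ` X = X"
    using closed inj fin by (intro endo_inj_surj) auto
  then have "(\<Sum>y\<in>X. k y) = (\<Sum>y\<in>X. y)"
    using sum.reindex[OF inj, of "\<lambda>y. y"] by simp
  then show ?thesis
    using sum_strict_mono_ex1[OF fin, of "\<lambda>y. y" k] ge \<open>x \<in> X\<close> by (metis le_neq_implies_less less_irrefl)
qed

text \<open>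
  The composition of two reversals increases on fibres, hence is the identity.  This gives both that
  a reversal is an involution (\<open>g = h\<close>) and that there is only one reversal.  All identities between
  reversals used later are obtained from this uniqueness.
\<close>

lemma fibre_reversals_cancel:
  assumes "finite X" "fibre_reversal X f g" "fibre_reversal X f h"
  shows "g (h x) = x"
proof (cases "x \<in> X")
  case True
  have "(g \<circ> h) x = x"
  proof (rule fibrewise_increasing_is_identity[OF assms(1) _ _ True, where f = f])
    show "\<And>x. x \<in> X \<Longrightarrow> (g \<circ> h) x \<in> X \<and> f ((g \<circ> h) x) = f x"
      using fibre_reversalD[OF assms(2)] fibre_reversalD[OF assms(3)] by simp
    show "fibrewise_monotone (<) X f (g \<circ> h)"
      unfolding fibrewise_monotone_def
      using fibre_reversalD[OF assms(2)] fibre_reversalD[OF assms(3)] by simp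
  qed
  then show ?thesis by simp
next
  case False
  then show ?thesis
    using fibre_reversalD(4)[OF assms(2)] fibre_reversalD(4)[OF assms(3)] by simp
qed

lemma fibre_reversal_unique:
  assumes "finite X" "fibre_reversal X f g" "fibre_reversal X f h"
  shows "g = h"
  using fibre_reversals_cancel[OF assms(1,2,2)] fibre_reversals_cancel[OF assms]
  by (metis ext)

lemma finite_set_reversal_exists:
  fixes A :: "nat set"
  assumes "finite A"
  shows "\<exists>g. \<forall>x\<in>A. g x \<in> A \<and> (\<forall>y\<in>A. x < y \<longrightarrow> g y < g x)"
proof -
  obtain h where h: "bij_betw h {..<card A} A" "strict_mono_on {..<card A} h"
    using ex_bij_betw_strict_mono_card[OF assms] by metis
  define r where "r = inv_into {..<card A} h"
  have r: "r x < card A" "h (r x) = x" if "x \<in> A" for x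
    using that h(1) unfolding r_def bij_betw_def
    by (metis inv_into_into lessThan_iff, metis f_inv_into_f)
  have r_mono: "r x < r y" if "x \<in> A" "y \<in> A" "x < y" for x y
    using that r h(2) by (metis lessThan_iff not_less_iff_gr_or_eq strict_mono_onD)
  have "h (card A - 1 - r x) \<in> A" if "x \<in> A" for x
    using that r(1)[OF that] h(1) by (intro bij_betwE[OF h(1), rule_format]) auto
  moreover have "h (card A - 1 - r y) < h (card A - 1 - r x)" if "x \<in> A" "y \<in> A" "x < y" for x y
    using r(1)[OF that(1)] r(1)[OF that(2)] r_mono[OF that] by (intro strict_mono_onD[OF h(2)]) auto
  ultimately show ?thesis
    by (intro exI[of _ "\<lambda>x. h (card A - 1 - r x)"]) blast
qed

lemma fibre_reversal_exists:
  assumes "finite X"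
  shows "\<exists>g. fibre_reversal X f g"
proof -
  have "\<forall>v. \<exists>g. \<forall>x\<in>{x\<in>X. f x = v}. g x \<in> {x\<in>X. f x = v} \<and>
      (\<forall>y\<in>{x\<in>X. f x = v}. x < y \<longrightarrow> g y < g x)"
    using assms by (intro allI finite_set_reversal_exists) simp
  then obtain G where G: "\<And>v x. x \<in> X \<Longrightarrow> f x = v \<Longrightarrow> G v x \<in> X \<and> f (G v x) = v \<and>
      (\<forall>y\<in>X. f y = v \<longrightarrow> x < y \<longrightarrow> G v y < G v x)"
    by (auto dest!: choice)
  have "fibre_reversal X f (\<lambda>x. if x \<in> X then G (f x) x else x)"
    unfolding fibre_reversal_def fibrewise_monotone_def using G by auto
  then show ?thesis by blast
qed

definition rev_fibres :: "nat set \<Rightarrow> (nat \<Rightarrow> 'b) \<Rightarrow> nat \<Rightarrow> nat" where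
  "rev_fibres X f = (SOME g. fibre_reversal X f g)"

lemma rev_fibres: "finite X \<Longrightarrow> fibre_reversal X f (rev_fibres X f)"
  unfolding rev_fibres_def using someI_ex[OF fibre_reversal_exists] .

lemma rev_fibres_eqI: "finite X \<Longrightarrow> fibre_reversal X f g \<Longrightarrow> rev_fibres X f = g"
  using fibre_reversal_unique rev_fibres by blast

section \<open>Exchanging block-increasing and block-decreasing involutions\<close>

text \<open>
  The fibres of this label are the segments of \<open>s\<close>: the elements of one block that \<open>s\<close> sends
  into one common block.
\<close>

definition pair_label :: "(nat \<Rightarrow> nat) \<Rightarrow> (nat \<Rightarrow> nat) \<Rightarrow> nat \<Rightarrow> nat \<times> nat" where
  "pair_label b s x = (b x, b (s x))"

definition exchange :: "nat set \<Rightarrow> (nat \<Rightarrow> nat) \<Rightarrow> (nat \<Rightarrow> nat) \<Rightarrow> nat \<Rightarrow> nat" where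
  "exchange X b s = rev_fibres X b \<circ> s \<circ> rev_fibres X (pair_label b s) \<circ> rev_fibres X b"

definition involutions_on :: "nat set \<Rightarrow> (nat \<Rightarrow> nat) set" where
  "involutions_on X = {s. s permutes X \<and> s \<circ> s = id}"

lemma involutions_onI:
  assumes "\<And>x. s (s x) = x" "\<And>x. x \<notin> X \<Longrightarrow> s x = x"
  shows "s \<in> involutions_on X"
  unfolding involutions_on_def permutes_def using assms by (auto, metis)

lemma involutions_onD:
  assumes "s \<in> involutions_on X"
  shows "s (s x) = x" "x \<in> X \<Longrightarrow> s x \<in> X" "x \<notin> X \<Longrightarrow> s x = x"
  using assms unfolding involutions_on_def
  by (auto simp: permutes_in_image permutes_not_in fun_eq_iff)

text \<open>
  The involution \<open>s\<close> matches the \<open>(i, j)\<close> segment with the \<open>(j, i)\<close> segment monotonically, in one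
  direction or the other, so it carries the reversal of one to the reversal of the other.
  Consequently \<open>s \<circ> u\<close>, with \<open>u\<close> the reversal of all segments, is again an involution.
\<close>

lemma rev_fibres_pair_label_conjugate:
  assumes X: "finite X" and s: "s \<in> involutions_on X"
    and R: "R = (<) \<or> R = (>)" and mono: "fibrewise_monotone R X b s"
  shows "s (rev_fibres X (pair_label b s) (s x)) = rev_fibres X (pair_label b s) x"
proof -
  define u where "u = rev_fibres X (pair_label b s)"
  note s_simps = involutions_onD[OF s]
  note u = fibre_reversalD[OF rev_fibres[OF X, of "pair_label b s"], folded u_def]
  have u_b: "b (u x) = b x" "b (s (u x)) = b (s x)" if "x \<in> X" for x
    using u(2)[OF that] by (auto simp: pair_label_def)
  have s_mono: "R (s x) (s y)" if "x \<in> X" "y \<in> X" "b x = b y" "x < y" for x y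
    using fibrewise_monotoneD[OF mono] that by blast
  have u_anti: "u y < u x" if "x \<in> X" "y \<in> X" "b x = b y" "b (s x) = b (s y)" "x < y" for x y
    using u(3) that by (simp add: pair_label_def)
  have "s (u (s y)) < s (u (s x))"
    if xy: "x \<in> X" "y \<in> X" "b x = b y" "b (s x) = b (s y)" "x < y" for x y
    using R
  proof
    assume R: "R = (<)"
    have "s x < s y" using s_mono[of x y] xy R by simp
    then have "u (s y) < u (s x)" using u_anti xy s_simps by simp
    then show ?thesis using s_mono[of "u (s y)" "u (s x)"] R xy u(1) u_b s_simps by simp
  next
    assume R: "R = (>)"
    have "s y < s x" using s_mono[of x y] xy R by simp
    then have "u (s x) < u (s y)" using u_anti xy s_simps by simp
    then show ?thesis using s_mono[of "u (s x)" "u (s y)"] R xy u(1) u_b s_simps by simp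
  qed
  then have "fibre_reversal X (pair_label b s) (\<lambda>x. s (u (s x)))"
    unfolding fibre_reversal_def fibrewise_monotone_def pair_label_def
    using s_simps u(1,4) u_b by simp
  from rev_fibres_eqI[OF X this] show ?thesis
    unfolding u_def by metis
qed

text \<open>
  Two elements of one block that \<open>s\<close> sends to different blocks have their order after
  \<open>w \<circ> s \<circ> u \<circ> w\<close> governed by the order of the target blocks, which only the inner \<open>w\<close> affects;
  for two elements of one segment all three reversals act.  One or three reversals both turn \<open>R\<close>
  into its converse.  The map undoes itself because the segments of the new involution are the
  \<open>w\<close>-images of the old ones, so that their reversal is \<open>w \<circ> u \<circ> w\<close>.
\<close>

lemma exchange_correct:
  assumes X: "finite X" and b: "mono b" and s: "s \<in> involutions_on X"
    and R: "R = (<) \<or> R = (>)" and mono: "fibrewise_monotone R X b s"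
  shows "exchange X b s \<in> involutions_on X"
    and "fibrewise_monotone (\<lambda>x y. R y x) X b (exchange X b s)"
    and "exchange X b (exchange X b s) = s"
proof -
  define u where "u = rev_fibres X (pair_label b s)"
  define w where "w = rev_fibres X b"
  define t where "t = exchange X b s"
  have t: "t x = w (s (u (w x)))" for x
    by (simp add: t_def exchange_def u_def w_def)
  note s_simps = involutions_onD[OF s]
  note u_rev = rev_fibres[OF X, of "pair_label b s", folded u_def]
  note w_rev = rev_fibres[OF X, of b, folded w_def]
  note u = fibre_reversalD[OF u_rev]
  note w = fibre_reversalD[OF w_rev]
  have ww: "w (w x) = x" for x by (rule fibre_reversals_cancel[OF X w_rev w_rev])
  have uu: "u (u x) = x" for x by (rule fibre_reversals_cancel[OF X u_rev u_rev])
  have sus: "s (u (s x)) = u x" for x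
    using rev_fibres_pair_label_conjugate[OF X s R mono] by (simp add: u_def)
  have u_b: "b (u x) = b x" "b (s (u x)) = b (s x)" if "x \<in> X" for x
    using u(2)[OF that] by (auto simp: pair_label_def)
  have u_anti: "u y < u x" if "x \<in> X" "y \<in> X" "b x = b y" "b (s x) = b (s y)" "x < y" for x y
    using u(3) that by (simp add: pair_label_def)
  have s_mono: "R (s x) (s y)" if "x \<in> X" "y \<in> X" "b x = b y" "x < y" for x y
    using fibrewise_monotoneD[OF mono] that by blast
  have b_less: "x < y" if "b x < b y" for x y
    using b that by (metis monoD not_le)
  have t_in: "t x \<in> X" "b (t x) = b (s (w x))" if "x \<in> X" for x
    using that by (simp_all add: t w s_simps u u_b)
  show t_inv: "exchange X b s \<in> involutions_on X"
    unfolding t_def[symmetric]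
    by (rule involutions_onI) (use t ww sus uu s_simps w u in simp_all)
  have t_mono: "R (t y) (t x)" if xy: "x \<in> X" "y \<in> X" "b x = b y" "x < y" for x y
  proof (cases "b (s (w x)) = b (s (w y))")
    \<comment> \<open>Same segment: each of \<open>w\<close>, \<open>u\<close> and \<open>w\<close> reverses the order once.\<close>
    case True
    have wxy: "w y < w x" "w x \<in> X" "w y \<in> X" "b (w x) = b (w y)" using xy w by auto
    have "u (w x) < u (w y)" using u_anti wxy True by simp
    then have "R (s (u (w x))) (s (u (w y)))"
      using s_mono wxy u(1) u_b by simp
    moreover have "s (u (w x)) \<in> X" "s (u (w y)) \<in> X" "b (s (u (w x))) = b (s (u (w y)))"
      using wxy u(1) s_simps u_b True by auto
    ultimately show ?thesis using R w(3) by (auto simp: t)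
  next
    \<comment> \<open>Different segments: \<open>u\<close> and the outer \<open>w\<close> move elements only within blocks, so comparing
      the blocks of the images is enough.\<close>
    case False
    have "R (s (w y)) (s (w x))"
      using s_mono xy w by simp
    then have "R (b (s (w y))) (b (s (w x)))"
      using R False monoD[OF b] by (metis le_neq_implies_less less_imp_le)
    then have "R (b (t y)) (b (t x))" using t_in xy by simp
    then show ?thesis using R b_less by auto
  qed
  then show "fibrewise_monotone (\<lambda>x y. R y x) X b (exchange X b s)"
    by (simp add: fibrewise_monotone_def t_def)
  have "fibre_reversal X (pair_label b t) (\<lambda>x. w (u (w x)))"
    unfolding fibre_reversal_def fibrewise_monotone_def
    using t_in u u_b w u_anti ww by (auto simp: pair_label_def)
  from rev_fibres_eqI[OF X this]
  have u_t: "rev_fibres X (pair_label b t) = (\<lambda>x. w (u (w x)))" .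
  show "exchange X b (exchange X b s) = s"
    unfolding t_def[symmetric] exchange_def[of X b t] u_t w_def[symmetric]
    by (rule ext) (simp add: t ww uu)
qed

lemma card_increasing_eq_card_decreasing:
  fixes b :: "nat \<Rightarrow> nat"
  assumes "finite X" "mono b"
  shows "card {s \<in> involutions_on X. fibrewise_monotone (<) X b s} =
         card {s \<in> involutions_on X. fibrewise_monotone (>) X b s}"
proof (rule bij_betw_same_card)
  show "bij_betw (exchange X b) {s \<in> involutions_on X. fibrewise_monotone (<) X b s}
     {s \<in> involutions_on X. fibrewise_monotone (>) X b s}"
    by (rule bij_betw_byWitness[where f' = "exchange X b"])
      (use exchange_correct[OF assms, where R = "(<)"] exchange_correct[OF assms, where R = "(>)"] in auto)
qed

section \<open>Descent sets\<close>

text \<open>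
  The index of the block containing \<open>x\<close> when the line is cut directly after each element of \<open>S\<close>.
\<close>

definition cut_blocks :: "nat set \<Rightarrow> nat \<Rightarrow> nat" where
  "cut_blocks S x = card {i \<in> S. i < x}"

lemma mono_cut_blocks: "finite S \<Longrightarrow> mono (cut_blocks S)"
  unfolding cut_blocks_def by (intro monoI card_mono) auto

lemma cut_blocks_eq_iff:
  assumes "finite S" "x \<le> y"
  shows "cut_blocks S x = cut_blocks S y \<longleftrightarrow> (\<forall>i. x \<le> i \<and> i < y \<longrightarrow> i \<notin> S)"
proof
  assume eq: "cut_blocks S x = cut_blocks S y"
  have "{i \<in> S. i < x} = {i \<in> S. i < y}"
    using eq assms unfolding cut_blocks_def by (intro card_subset_eq) auto
  then show "\<forall>i. x \<le> i \<and> i < y \<longrightarrow> i \<notin> S"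
    by (auto simp: set_eq_iff not_less[symmetric])
next
  assume "\<forall>i. x \<le> i \<and> i < y \<longrightarrow> i \<notin> S"
  then have "{i \<in> S. i < x} = {i \<in> S. i < y}"
    using assms by (auto simp: not_less[symmetric])
  then show "cut_blocks S x = cut_blocks S y" by (simp add: cut_blocks_def)
qed

text \<open>
  Blocks are intervals, so monotonicity on a block is a condition on neighbouring positions:
  the pair \<open>i, i + 1\<close> lies in one block iff \<open>i\<close> is not a cut.
\<close>

lemma fibrewise_monotone_cut_blocks_iff:
  assumes "finite S" "transp R"
  shows "fibrewise_monotone R {1..n} (cut_blocks S) s \<longleftrightarrow>
         (\<forall>i. 1 \<le> i \<and> i < n \<and> i \<notin> S \<longrightarrow> R (s i) (s (Suc i)))"
proof (intro iffI allI impI)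
  fix i assume "fibrewise_monotone R {1..n} (cut_blocks S) s" "1 \<le> i \<and> i < n \<and> i \<notin> S"
  moreover from this have "cut_blocks S i = cut_blocks S (Suc i)"
    using cut_blocks_eq_iff[OF assms(1), of i "Suc i"] by (auto simp: less_Suc_eq)
  ultimately show "R (s i) (s (Suc i))"
    unfolding fibrewise_monotone_def by simp
next
  assume steps: "\<forall>i. 1 \<le> i \<and> i < n \<and> i \<notin> S \<longrightarrow> R (s i) (s (Suc i))"
  have "R (s x) (s y)" if "Suc x \<le> y" "1 \<le> x" "y \<le> n" "\<forall>i. x \<le> i \<and> i < y \<longrightarrow> i \<notin> S" for x y
    using that
  proof (induction y rule: dec_induct)
    case base
    then show ?case using steps by simp
  next
    case (step y)
    then have "R (s x) (s y)" "R (s y) (s (Suc y))"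
      using steps by auto
    then show ?case using assms(2) by (blast dest: transpD)
  qed
  then show "fibrewise_monotone R {1..n} (cut_blocks S) s"
    unfolding fibrewise_monotone_def using cut_blocks_eq_iff[OF assms(1)] by auto
qed

lemma involutions_eq: "involutions n = involutions_on {1..n}"
  by (simp add: involutions_def involutions_on_def)

lemma finite_involutions: "finite (involutions n)"
  by (rule finite_subset[OF _ finite_permutations[of "{1..n}"]]) (auto simp: involutions_def)

lemma Des_subset: "Des n p \<subseteq> {1..<n}"
  by (auto simp: Des_def)

lemma card_Des_subset_eq_card_ascents_subset:
  assumes "S \<subseteq> {1..<n}"
  shows "card {p \<in> involutions n. Des n p \<subseteq> S} = card {p \<in> involutions n. {1..<n} - Des n p \<subseteq> S}"
proof -
  have S: "finite S" using assms finite_subset by blast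
  have "Des n p \<subseteq> S \<longleftrightarrow> fibrewise_monotone (<) {1..n} (cut_blocks S) p"
    and "{1..<n} - Des n p \<subseteq> S \<longleftrightarrow> fibrewise_monotone (>) {1..n} (cut_blocks S) p"
    if "p \<in> involutions n" for p
  proof -
    have "inj p" using that permutes_inj by (auto simp: involutions_def)
    then have neq: "p i \<noteq> p (Suc i)" for i by (simp add: inj_eq)
    have "Des n p \<subseteq> S \<longleftrightarrow> (\<forall>i. 1 \<le> i \<and> i < n \<and> i \<notin> S \<longrightarrow> p i < p (Suc i))"
      using neq by (auto simp: Des_def subset_iff) (metis not_less_iff_gr_or_eq)+
    then show "Des n p \<subseteq> S \<longleftrightarrow> fibrewise_monotone (<) {1..n} (cut_blocks S) p"
      by (subst fibrewise_monotone_cut_blocks_iff[OF S]) auto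
    show "{1..<n} - Des n p \<subseteq> S \<longleftrightarrow> fibrewise_monotone (>) {1..n} (cut_blocks S) p"
      by (subst fibrewise_monotone_cut_blocks_iff[OF S]) (auto simp: Des_def subset_iff)
  qed
  then have "{p \<in> involutions n. Des n p \<subseteq> S} =
      {p \<in> involutions_on {1..n}. fibrewise_monotone (<) {1..n} (cut_blocks S) p}"
    "{p \<in> involutions n. {1..<n} - Des n p \<subseteq> S} =
      {p \<in> involutions_on {1..n}. fibrewise_monotone (>) {1..n} (cut_blocks S) p}"
    by (auto simp: involutions_eq)
  then show ?thesis
    using card_increasing_eq_card_decreasing[OF _ mono_cut_blocks[OF S]] by simp
qed

text \<open>
  Moebius inversion over the subsets of \<open>S\<close>: the count for \<open>\<subseteq> S\<close> is the count for \<open>= S\<close> plus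
  the counts for the proper subsets, which agree by induction.
\<close>

lemma card_eq_if_card_subset_eq:
  fixes D E :: "'a \<Rightarrow> 'b set"
  assumes "finite A" "finite S"
    and eq: "\<And>T. T \<subseteq> S \<Longrightarrow> card {p \<in> A. D p \<subseteq> T} = card {p \<in> A. E p \<subseteq> T}"
  shows "card {p \<in> A. D p = S} = card {p \<in> A. E p = S}"
  using assms(2) eq
proof (induction S rule: finite_psubset_induct)
  case (psubset S)
  have split: "card {p \<in> A. F p \<subseteq> S} =
      card {p \<in> A. F p = S} + (\<Sum>T\<in>Pow S - {S}. card {p \<in> A. F p = T})" for F :: "'a \<Rightarrow> 'b set"
  proof -
    have "{p \<in> A. F p \<subseteq> S} = (\<Union>T\<in>Pow S. {p \<in> A. F p = T})" by auto
    also have "card \<dots> = (\<Sum>T\<in>Pow S. card {p \<in> A. F p = T})"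
      using assms(1) psubset.hyps by (intro card_UN_disjoint) auto
    also have "\<dots> = card {p \<in> A. F p = S} + (\<Sum>T\<in>Pow S - {S}. card {p \<in> A. F p = T})"
      using psubset.hyps by (intro sum.remove) auto
    finally show ?thesis .
  qed
  have "(\<Sum>T\<in>Pow S - {S}. card {p \<in> A. D p = T}) = (\<Sum>T\<in>Pow S - {S}. card {p \<in> A. E p = T})"
    using psubset.IH psubset.prems by (intro sum.cong) auto
  then show ?case using split[of D] split[of E] psubset.prems[of S] by simp
qed

text \<open>
  Equidistribution of descent sets and their complements, stated for an arbitrary weight so that
  number and sum of the descents are covered alike.
\<close>

lemma sum_Des_eq_sum_ascents:
  fixes F :: "nat set \<Rightarrow> int"
  shows "(\<Sum>p\<in>involutions n. F (Des n p)) = (\<Sum>p\<in>involutions n. F ({1..<n} - Des n p))"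
proof -
  have by_value: "(\<Sum>p\<in>involutions n. F (D p)) =
      (\<Sum>T\<in>Pow {1..<n}. int (card {p \<in> involutions n. D p = T}) * F T)"
    if "\<And>p. D p \<subseteq> {1..<n}" for D
  proof -
    have "(\<Sum>p\<in>involutions n. F (D p)) =
        (\<Sum>T\<in>Pow {1..<n}. \<Sum>p\<in>{p \<in> involutions n. D p = T}. F (D p))"
      using that finite_involutions by (intro sum.group[symmetric]) auto
    then show ?thesis by simp
  qed
  have "card {p \<in> involutions n. Des n p = T} = card {p \<in> involutions n. {1..<n} - Des n p = T}"
    if "T \<in> Pow {1..<n}" for T
    using that finite_subset[of T "{1..<n}"] finite_involutions
    by (intro card_eq_if_card_subset_eq card_Des_subset_eq_card_ascents_subset) auto
  then show ?thesis
    unfolding by_value[of "Des n", OF Des_subset] by_value[of "\<lambda>p. {1..<n} - Des n p", OF Diff_subset]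
    by (intro sum.cong) simp_all
qed

theorem corollary2p4:
  fixes n :: nat
  assumes "n \<ge> 1"
  shows "(\<forall>i\<le>n - 1. coeff (inv_des_poly n) i = coeff (inv_des_poly n) (n - 1 - i)) \<and>
         (\<forall>j\<le>n choose 2. coeff (inv_maj_poly n) j = coeff (inv_maj_poly n) ((n choose 2) - j))"
proof (intro conjI allI impI)
  fix i assume i: "i \<le> n - 1"
  have "card ({1..<n} - Des n p) = i \<longleftrightarrow> des n p = n - 1 - i" for p
  proof -
    have "finite (Des n p)" using Des_subset finite_subset by blast
    then have "card ({1..<n} - Des n p) = n - 1 - des n p"
      using Des_subset by (simp add: card_Diff_subset des_def)
    moreover have "des n p \<le> n - 1"
      using card_mono[OF _ Des_subset[of n p]] by (simp add: des_def)
    ultimately show ?thesis using i by linarith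
  qed
  then show "coeff (inv_des_poly n) i = coeff (inv_des_poly n) (n - 1 - i)"
    \<comment> \<open>The coefficient of \<open>t^i\<close> is the sum of the indicator of \<open>card T = i\<close> over all descent sets.\<close>
    using sum_Des_eq_sum_ascents[where F = "\<lambda>T. if card T = i then 1 else 0" and n = n]
    by (simp add: inv_des_poly_def coeff_sum des_def)
next
  fix j assume j: "j \<le> n choose 2"
  have "\<Sum>{1..<n} = n choose 2"
    using gauss_sum_from_Suc_0[of "n - 1", where 'a = nat] assms
    by (simp add: choose_two atLeastLessThanSuc_atLeastAtMost[symmetric] mult.commute)
  moreover have "\<Sum>({1..<n} - Des n p) + maj n p = \<Sum>{1..<n}" for p
    unfolding maj_def using sum.subset_diff[OF Des_subset, of n "\<lambda>i. i" p] by simp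
  ultimately have "\<Sum>({1..<n} - Des n p) = j \<longleftrightarrow> maj n p = (n choose 2) - j" for p
    using j by (metis (no_types, lifting) add_diff_cancel_left' add_diff_cancel_right' le_add_diff_inverse)
  then show "coeff (inv_maj_poly n) j = coeff (inv_maj_poly n) ((n choose 2) - j)"
    using sum_Des_eq_sum_ascents[where F = "\<lambda>T. if \<Sum>T = j then 1 else 0" and n = n]
    by (simp add: inv_maj_poly_def coeff_sum maj_def)
qed

end
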